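(* Fix $T>0$, let $\phi\in C^\infty_{\mathrm{poly}}(\mathbb{R}^d)$ and let $\mathcal{P}=\phi(\mathbf{X}(T))$. Suppose that $\mathbf{Z}_n=[\mathbf{X}_n,\mathbf{Y}_n]$ (computed with time step $h$) is a weak second-order approximation to the solution $\mathbf{Z}(t)=[\mathbf{X}(t),\mathbf{Y}(t)]$ of the doubled-up system. For each level $\ell\ge 1$, let $[\mathcal{P}_\ell^{(i)},\mathcal{P}_{\ell-1}^{(i)}]$, $i=1,\dots,N_\ell$, be i.i.d. samples of $[\phi(\mathbf{X}_M),\phi(\mathbf{Y}_M)]$ computed with $h=h_\ell$ and $Mh=T$ (and, for $\ell=0$, let $\mathcal{P}_0^{(i)}$ be i.i.d. samples of $\phi(\mathbf{X}_M)$ with $h=h_0$, $Mh=T$). Then, provided the time steps $h_\ell$ are sufficiently small, there exist $\alpha\ge \tfrac12$ and positive constants $c_1,c_2$, independent of $\ell$ and of the sample numbers $N_\ell$, such that for all $\ell\geq 0$: (i) $\bigl|\mathbb{E}[\widehat{\mathcal{P}}_\ell-\mathcal{P}]\bigr|\le c_1 h_\ell^\alpha$; (ii) $\mathbb{E}[\widehat{Y}_{\ell,N_\ell}]=\mathbb{E}[\widehat{\mathcal{P}}_0]$ if $\ell=0$, and $\mathbb{E}[\widehat{Y}_{\ell,N_\ell}]=\mathbb{E}[\widehat{\mathcal{P}}_\ell-\widehat{\mathcal{P}}_{\ell-1}]$ if $\ell>0$; (iii) $\operatorname{Var}[\widehat{Y}_{\ell,N_\ell}]\le c_2 N_\ell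^{-1}h_\ell^2$.
   Context: SDE. Let $\mathbf{f}\colon\mathbb{R}^d\to\mathbb{R}^d$, $G\colon\mathbb{R}^d\to\mathbb{R}^{d\times m}$, $\mathbf{X}_0\in\mathbb{R}^d$, and let $\mathbf{W}(t)$ be a vector of $m$ i.i.d. standard Brownian motions on a probability space. It is assumed that the Ito SDE $d\mathbf{X}=\mathbf{f}(\mathbf{X})\,dt+G(\mathbf{X})\,d\mathbf{W}(t)$, $\mathbf{X}(0)=\mathbf{X}_0$, has a well-defined solution. Doubled-up system. $\mathbf{Z}=[\mathbf{X},\mathbf{Y}]\in\mathbb{R}^{2d}$ solves $$d\mathbf{X}=\mathbf{f}(\mathbf{X})\,dt+G(\mathbf{X})\,d\mathbf{W}(t),\quad \mathbf{X}(0)=\mathbf{X}_0,\qquad d\mathbf{Y}=\mathbf{f}(\mathbf{Y})\,dt+G(\mathbf{Y})\,d\mathbf{W}(t),\quad \mathbf{Y}(0)=\mathbf{X}_0,$$ with the same initial data and the same Brownian motion $\mathbf{W}$ in both components, so that $\mathbf{X}(t)=\mathbf{Y}(t)$ almost surely. For a time step $h>0$, $\mathbf{X}(t_n)$ and $\mathbf{Y}(t_n)$, $t_n=nh$, are approximated by (possibly different) numerical integrators giving random variables $\mathbf{X}_n,\mathbf{Y}_n$ defined on a common probability space, and $\mathbf{Z}_n=[\mathbf{X}_n,\mathbf{Y}_n]$. Test functions. $C^\infty_{\mathrm{poly}}(\mathbb{R}^k)$ is the set of infinitely differentiable functions $\mathbb{R}^k\to\mathbb{R}$ all of whose derivatives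 (including the function itself) are polynomially bounded. Weak approximation. Random variables $\mathbf{U}_n$ (depending on $h$) with values in $\mathbb{R}^k$ are a weak order-$\alpha$ approximation to a process $\mathbf{U}(t)$ if for all $\varphi\in C^\infty_{\mathrm{poly}}(\mathbb{R}^k)$ and $T>0$ there exists $K>0$ such that, for $h$ sufficiently small, $|\mathbb{E}[\varphi(\mathbf{U}(T))]-\mathbb{E}[\varphi(\mathbf{U}_M)]|\le K h^\alpha$ where $Mh=T$ (in particular these expectations are finite). Weak second-order means $\alpha=2$. Multilevel setting. $M_\ell=M_0 2^\ell$ with $M_0\in\mathbb{N}$ fixed, $h_\ell=T/M_\ell$, $N_\ell\in\mathbb{N}$ is the number of samples on level $\ell$. $\widehat{\mathcal{P}}_\ell=\frac1{N_\ell}\sum_{i=1}^{N_\ell}\mathcal{P}_\ell^{(i)}$ is the Monte Carlo estimator on level $\ell$, $\widehat{Y}_{0,N_0}=\widehat{\mathcal{P}}_0$, and for $\ell\ge1$, $\widehat{Y}_{\ell,N_\ell}=\frac1{N_\ell}\sum_{i=1}^{N_\ell}Y_\ell^{(i)}$ with $Y_\ell^{(i)}=\mathcal{P}_\ell^{(i)}-\mathcal{P}_{\ell-1}^{(i)}$. As always in this setting, the approximation belonging to a given level has the same distribution wherever it appears: for $\ell\ge1$, $\phi(\mathbf{Y}_M)$ computed with $h=h_\ell$ has the same distribution as $\phi(\mathbf{X}_M)$ computed with $h=h_{\ell-1}$. The constants may depend on $M_0$, $T$, $\phi$. *)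

theory Defs
  imports "HOL-Probability.Probability"
begin

section \<open>Test functions\<close>

primrec iter_partial :: "'a::euclidean_space list \<Rightarrow> ('a \<Rightarrow> real) \<Rightarrow> 'a \<Rightarrow> real" where
  "iter_partial [] g = g"
| "iter_partial (b # bs) g = (\<lambda>x. frechet_derivative (iter_partial bs g) (at x) b)"

text \<open>Total differentiability of all iterated partial derivatives is the same as being
  infinitely differentiable; the empty list accounts for the function itself. The growth constants
  may depend on the derivative.\<close>

definition C_inf_poly :: "('a::euclidean_space \<Rightarrow> real) set" where
  "C_inf_poly = {g. \<forall>bs\<in>lists Basis.
     (\<forall>x. iter_partial bs g differentiable (at x)) \<and>
     (\<exists>C. \<exists>k::nat. \<forall>x. \<bar>iter_partial bs g x\<bar> \<le> C * (1 + norm x ^ k))}"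

section \<open>Brownian motion, Ito integral, stochastic differential equations\<close>

text \<open>Only nonnegative times matter. Independence of the whole increment vector from the past
  together with independence of its coordinates makes the coordinate processes of \<open>W\<close>
  i.i.d. standard Brownian motions.\<close>

definition brownian_motion ::
  "'w measure \<Rightarrow> (real \<Rightarrow> 'w measure) \<Rightarrow> (real \<Rightarrow> 'w \<Rightarrow> real^'m) \<Rightarrow> bool" where
  "brownian_motion M F W \<longleftrightarrow>
     (\<forall>t\<ge>0. W t \<in> borel_measurable (F t)) \<and>
     (AE \<omega> in M. W 0 \<omega> = 0) \<and>
     (\<forall>\<omega>\<in>space M. continuous_on {0..} (\<lambda>t. W t \<omega>)) \<and>
     (\<forall>s t. 0 \<le> s \<and> s < t \<longrightarrow>
        prob_space.indep_set M (sets (F s))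
          {(\<lambda>\<omega>. W t \<omega> - W s \<omega>) -` A \<inter> space M | A. A \<in> sets borel} \<and>
        prob_space.indep_vars M (\<lambda>_. borel) (\<lambda>j \<omega>. (W t \<omega> - W s \<omega>) $ j) UNIV \<and>
        (\<forall>j. distributed M lborel (\<lambda>\<omega>. (W t \<omega> - W s \<omega>) $ j)
               (normal_density 0 (sqrt (t - s)))))"

text \<open>A simple integrand on the time interval from 0 to \<open>t\<close> is given by a partition
  \<open>0 = \<tau> 0 < \<dots> < \<tau> n = t\<close> and bounded matrices \<open>\<xi> k\<close>, known at time \<open>\<tau> k\<close>, that are its values on
  \<open>{\<tau> k<..\<tau> (Suc k)}\<close>.\<close>

definition simple_integrand ::
  "'w measure \<Rightarrow> (real \<Rightarrow> 'w measure) \<Rightarrow> real \<Rightarrow> nat \<Rightarrow> (nat \<Rightarrow> real) \<Rightarrow> (nat \<Rightarrow> 'w \<Rightarrow> real^'m^'d) \<Rightarrow> bool"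
  where
  "simple_integrand M F t n \<tau> \<xi> \<longleftrightarrow>
     \<tau> 0 = 0 \<and> \<tau> n = t \<and>
     (\<forall>k<n. \<tau> k < \<tau> (Suc k) \<and> \<xi> k \<in> borel_measurable (F (\<tau> k))) \<and>
     (\<exists>C. \<forall>k<n. \<forall>\<omega>\<in>space M. norm (\<xi> k \<omega>) \<le> C)"

definition step_process ::
  "nat \<Rightarrow> (nat \<Rightarrow> real) \<Rightarrow> (nat \<Rightarrow> 'w \<Rightarrow> real^'m^'d) \<Rightarrow> real \<Rightarrow> 'w \<Rightarrow> real^'m^'d" where
  "step_process n \<tau> \<xi> s \<omega> = (\<Sum>k<n. indicator {\<tau> k<..\<tau> (Suc k)} s *\<^sub>R \<xi> k \<omega>)"

definition step_ito ::
  "(real \<Rightarrow> 'w \<Rightarrow> real^'m) \<Rightarrow> nat \<Rightarrow> (nat \<Rightarrow> real) \<Rightarrow> (nat \<Rightarrow> 'w \<Rightarrow> real^'m^'d) \<Rightarrow> 'w \<Rightarrow> real^'d" where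
  "step_ito W n \<tau> \<xi> \<omega> = (\<Sum>k<n. \<xi> k \<omega> *v (W (\<tau> (Suc k)) \<omega> - W (\<tau> k) \<omega>))"

text \<open>\<open>has_ito_integral M F W H t I\<close>: the random vector \<open>I\<close> is (a version of) the Ito integral of
  the matrix-valued integrand \<open>H\<close> from 0 to \<open>t\<close>, that is, the limit in probability of
  the integrals of simple integrands whose squared \<open>L\<^sup>2\<close>-distance to \<open>H\<close> in time tends to 0 in
  probability. This covers exactly the integrands that are square integrable in time almost surely.\<close>

definition has_ito_integral ::
  "'w measure \<Rightarrow> (real \<Rightarrow> 'w measure) \<Rightarrow> (real \<Rightarrow> 'w \<Rightarrow> real^'m) \<Rightarrow> (real \<Rightarrow> 'w \<Rightarrow> real^'m^'d) \<Rightarrow>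
   real \<Rightarrow> ('w \<Rightarrow> real^'d) \<Rightarrow> bool" where
  "has_ito_integral M F W H t I \<longleftrightarrow>
     I \<in> borel_measurable M \<and>
     (\<forall>u\<in>{0..t}. (\<lambda>(s, \<omega>). H s \<omega>) \<in> borel_measurable (restrict_space borel {0..u} \<Otimes>\<^sub>M F u)) \<and>
     (\<exists>n \<tau> \<xi>. (\<forall>i::nat. simple_integrand M F t (n i) (\<tau> i) (\<xi> i)) \<and>
        (\<forall>\<epsilon>>0. (\<lambda>i. measure M {\<omega>\<in>space M. ennreal \<epsilon> <
            (\<integral>\<^sup>+s\<in>{0..t}. ennreal ((norm (step_process (n i) (\<tau> i) (\<xi> i) s \<omega> - H s \<omega>))\<^sup>2) \<partial>lborel)})
          \<longlonglongrightarrow> 0) \<and>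
        (\<forall>\<epsilon>>0. (\<lambda>i. measure M {\<omega>\<in>space M. \<epsilon> <
            norm (step_ito W (n i) (\<tau> i) (\<xi> i) \<omega> - I \<omega>)}) \<longlonglongrightarrow> 0))"

definition sde_solution ::
  "'w measure \<Rightarrow> (real \<Rightarrow> 'w measure) \<Rightarrow> (real \<Rightarrow> 'w \<Rightarrow> real^'m) \<Rightarrow>
   (real^'d \<Rightarrow> real^'d) \<Rightarrow> (real^'d \<Rightarrow> real^'m^'d) \<Rightarrow> real^'d \<Rightarrow> (real \<Rightarrow> 'w \<Rightarrow> real^'d) \<Rightarrow> bool" where
  "sde_solution M F W f G X0 X \<longleftrightarrow>
     (\<forall>t\<ge>0. X t \<in> borel_measurable (F t)) \<and>
     (\<forall>\<omega>\<in>space M. continuous_on {0..} (\<lambda>t. X t \<omega>)) \<and>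
     (AE \<omega> in M. X 0 \<omega> = X0) \<and>
     (\<forall>t\<ge>0. (AE \<omega> in M. set_integrable lborel {0..t} (\<lambda>s. f (X s \<omega>))) \<and>
        (\<exists>I. has_ito_integral M F W (\<lambda>s \<omega>. G (X s \<omega>)) t I \<and>
           (AE \<omega> in M. X t \<omega> = X0 + (LINT s:{0..t}|lborel. f (X s \<omega>)) + I \<omega>)))"

text \<open>Existence and pathwise uniqueness, so that both components of the doubled-up system, which are
  driven by the same Brownian motion, coincide almost surely.\<close>

definition sde_well_posed ::
  "'w measure \<Rightarrow> (real \<Rightarrow> 'w measure) \<Rightarrow> (real \<Rightarrow> 'w \<Rightarrow> real^'m) \<Rightarrow>
   (real^'d \<Rightarrow> real^'d) \<Rightarrow> (real^'d \<Rightarrow> real^'m^'d) \<Rightarrow> real^'d \<Rightarrow> bool" where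
  "sde_well_posed M F W f G X0 \<longleftrightarrow>
     (\<exists>X. sde_solution M F W f G X0 X) \<and>
     (\<forall>X Y. sde_solution M F W f G X0 X \<and> sde_solution M F W f G X0 Y \<longrightarrow>
        (AE \<omega> in M. \<forall>t\<ge>0. X t \<omega> = Y t \<omega>))"

definition doubled_up_solution ::
  "'w measure \<Rightarrow> (real \<Rightarrow> 'w measure) \<Rightarrow> (real \<Rightarrow> 'w \<Rightarrow> real^'m) \<Rightarrow>
   (real^'d \<Rightarrow> real^'d) \<Rightarrow> (real^'d \<Rightarrow> real^'m^'d) \<Rightarrow> real^'d \<Rightarrow>
   (real \<Rightarrow> 'w \<Rightarrow> (real^'d) \<times> (real^'d)) \<Rightarrow> bool" where
  "doubled_up_solution M F W f G X0 Z \<longleftrightarrow>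
     sde_solution M F W f G X0 (\<lambda>t \<omega>. fst (Z t \<omega>)) \<and>
     sde_solution M F W f G X0 (\<lambda>t \<omega>. snd (Z t \<omega>))"

section \<open>Weak approximation\<close>

text \<open>\<open>U_num h n\<close> is the \<open>n\<close>-th iterate computed with time step \<open>h\<close>; these random variables may live on
  a probability space \<open>Q\<close> different from that of the process \<open>U\<close>.\<close>

definition weak_approximation ::
  "real \<Rightarrow> 'q measure \<Rightarrow> (real \<Rightarrow> nat \<Rightarrow> 'q \<Rightarrow> 'a::euclidean_space) \<Rightarrow>
   'w measure \<Rightarrow> (real \<Rightarrow> 'w \<Rightarrow> 'a) \<Rightarrow> bool" where
  "weak_approximation \<alpha> Q U_num M U \<longleftrightarrow>
     (\<forall>h>0. \<forall>n. U_num h n \<in> borel_measurable Q) \<and>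
     (\<forall>\<phi>\<in>C_inf_poly. \<forall>T>0.
        integrable M (\<lambda>\<omega>. \<phi> (U T \<omega>)) \<and>
        (\<exists>K>0. \<exists>h0>0. \<forall>h n. 0 < h \<and> h \<le> h0 \<and> real n * h = T \<longrightarrow>
           integrable Q (\<lambda>\<omega>. \<phi> (U_num h n \<omega>)) \<and>
           \<bar>(LINT \<omega>|M. \<phi> (U T \<omega>)) - (LINT \<omega>|Q. \<phi> (U_num h n \<omega>))\<bar> \<le> K * h powr \<alpha>))"

section \<open>Multilevel Monte Carlo\<close>

definition level_steps :: "nat \<Rightarrow> nat \<Rightarrow> nat" where
  "level_steps M0 l = M0 * 2 ^ l"

definition level_h :: "real \<Rightarrow> nat \<Rightarrow> nat \<Rightarrow> real" where
  "level_h T M0 l = T / real (level_steps M0 l)"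

definition level_consistent ::
  "real \<Rightarrow> nat \<Rightarrow> ('a::euclidean_space \<Rightarrow> real) \<Rightarrow> 'q measure \<Rightarrow>
   (real \<Rightarrow> nat \<Rightarrow> 'q \<Rightarrow> 'a) \<Rightarrow> (real \<Rightarrow> nat \<Rightarrow> 'q \<Rightarrow> 'a) \<Rightarrow> bool" where
  "level_consistent T M0 \<phi> Q Xn Yn \<longleftrightarrow>
     (\<forall>l\<ge>1. distr Q borel (\<lambda>\<omega>. \<phi> (Yn (level_h T M0 l) (level_steps M0 l) \<omega>)) =
       distr Q borel (\<lambda>\<omega>. \<phi> (Xn (level_h T M0 (l - 1)) (level_steps M0 (l - 1)) \<omega>)))"

text \<open>\<open>Pf l i\<close> is the \<open>i\<close>-th fine sample on level \<open>l\<close>; for \<open>l \<ge> 1\<close>, \<open>Pc l i\<close> is the coarse sample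
  (of the level \<open>l - 1\<close> quantity) coupled to it. \<open>Pc 0\<close> is irrelevant. Nothing is assumed about
  the joint distribution of samples on different levels.\<close>

definition mlmc_samples ::
  "real \<Rightarrow> nat \<Rightarrow> ('a::euclidean_space \<Rightarrow> real) \<Rightarrow> 'q measure \<Rightarrow>
   (real \<Rightarrow> nat \<Rightarrow> 'q \<Rightarrow> 'a) \<Rightarrow> (real \<Rightarrow> nat \<Rightarrow> 'q \<Rightarrow> 'a) \<Rightarrow>
   'w measure \<Rightarrow> (nat \<Rightarrow> nat) \<Rightarrow> (nat \<Rightarrow> nat \<Rightarrow> 'w \<Rightarrow> real) \<Rightarrow> (nat \<Rightarrow> nat \<Rightarrow> 'w \<Rightarrow> real) \<Rightarrow> bool" where
  "mlmc_samples T M0 \<phi> Q Xn Yn M N Pf Pc \<longleftrightarrow>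
     prob_space.indep_vars M (\<lambda>_. borel) (Pf 0) {1..N 0} \<and>
     (\<forall>i\<in>{1..N 0}. distr M borel (Pf 0 i) =
        distr Q borel (\<lambda>\<omega>. \<phi> (Xn (level_h T M0 0) (level_steps M0 0) \<omega>))) \<and>
     (\<forall>l\<ge>1.
        prob_space.indep_vars M (\<lambda>_. borel) (\<lambda>i \<omega>. (Pf l i \<omega>, Pc l i \<omega>)) {1..N l} \<and>
        (\<forall>i\<in>{1..N l}. distr M borel (\<lambda>\<omega>. (Pf l i \<omega>, Pc l i \<omega>)) =
           distr Q borel (\<lambda>\<omega>. (\<phi> (Xn (level_h T M0 l) (level_steps M0 l) \<omega>),
                                \<phi> (Yn (level_h T M0 l) (level_steps M0 l) \<omega>)))))"

definition sample_mean :: "nat \<Rightarrow> (nat \<Rightarrow> 'w \<Rightarrow> real) \<Rightarrow> 'w \<Rightarrow> real" where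
  "sample_mean n A \<omega> = (\<Sum>i=1..n. A i \<omega>) / real n"

definition P_hat :: "(nat \<Rightarrow> nat) \<Rightarrow> (nat \<Rightarrow> nat \<Rightarrow> 'w \<Rightarrow> real) \<Rightarrow> nat \<Rightarrow> 'w \<Rightarrow> real" where
  "P_hat N Pf l = sample_mean (N l) (Pf l)"

definition Y_hat ::
  "(nat \<Rightarrow> nat) \<Rightarrow> (nat \<Rightarrow> nat \<Rightarrow> 'w \<Rightarrow> real) \<Rightarrow> (nat \<Rightarrow> nat \<Rightarrow> 'w \<Rightarrow> real) \<Rightarrow> nat \<Rightarrow> 'w \<Rightarrow> real" where
  "Y_hat N Pf Pc l =
     (if l = 0 then P_hat N Pf 0 else sample_mean (N l) (\<lambda>i \<omega>. Pf l i \<omega> - Pc l i \<omega>))"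

end

theory Submission
  imports Defs
begin

text \<open>The function \<open>(x, y) \<mapsto> (\<phi> x - \<phi> y)\<^sup>2\<close> is itself a test function, and its expectation at the exact
  solution \<open>[X, Y]\<close> vanishes because \<open>X = Y\<close> almost surely. Weak second-order approximation of the
  doubled-up system therefore bounds the second moment of \<open>\<phi> X\<^sub>M - \<phi> Y\<^sub>M\<close> by a multiple of \<open>h\<^sup>2\<close>, which
  gives the strong variance decay without any strong convergence. Averaging over independent samples
  divides the variance by their number.\<close>

section \<open>Smooth functions with polynomially bounded derivatives\<close>

definition poly_bounded :: "('a::real_normed_vector \<Rightarrow> real) \<Rightarrow> bool" where
  "poly_bounded u \<longleftrightarrow> (\<exists>C. \<exists>k::nat. \<forall>x. \<bar>u x\<bar> \<le> C * (1 + norm x ^ k))"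

text \<open>Powers of \<open>1 + norm x\<close> have a base of at least 1, so they increase with the
  exponent and multiply by adding exponents. With a nonnegative constant, bounds with different
  exponents therefore combine directly in sums and products.\<close>

lemma poly_bounded_iff:
  "poly_bounded u \<longleftrightarrow> (\<exists>C\<ge>0. \<exists>k::nat. \<forall>x. \<bar>u x\<bar> \<le> C * (1 + norm x) ^ k)"
proof
  assume "poly_bounded u"
  then obtain C and k :: nat where C: "\<bar>u x\<bar> \<le> C * (1 + norm x ^ k)" for x
    unfolding poly_bounded_def by blast
  \<comment> \<open>Both \<open>1\<close> and \<open>norm x ^ k\<close> are at most
    \<open>(1 + norm x) ^ k\<close>, hence the factor 2; the absolute value makes the constant
    nonnegative.\<close>
  have "\<bar>u x\<bar> \<le> (2 * \<bar>C\<bar>) * (1 + norm x) ^ k" for x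
  proof -
    have "1 + norm x ^ k \<le> 2 * (1 + norm x) ^ k"
      using add_mono[OF one_le_power[of "1 + norm x" k] power_mono[of "norm x" "1 + norm x" k]]
      by (simp del: one_le_power)
    then have "\<bar>C\<bar> * (1 + norm x ^ k) \<le> \<bar>C\<bar> * (2 * (1 + norm x) ^ k)"
      by (rule mult_left_mono) simp
    moreover have "C * (1 + norm x ^ k) \<le> \<bar>C\<bar> * (1 + norm x ^ k)"
      by (intro mult_right_mono) auto
    ultimately show ?thesis using C[of x] by simp
  qed
  then show "\<exists>C\<ge>0. \<exists>k::nat. \<forall>x. \<bar>u x\<bar> \<le> C * (1 + norm x) ^ k"
    by (intro exI[of _ "2 * \<bar>C\<bar>"]) auto
next
  assume "\<exists>C\<ge>0. \<exists>k::nat. \<forall>x. \<bar>u x\<bar> \<le> C * (1 + norm x) ^ k"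
  then obtain C and k :: nat where "C \<ge> 0" and C: "\<bar>u x\<bar> \<le> C * (1 + norm x) ^ k" for x
    by blast
  \<comment> \<open>The factor \<open>2 ^ k\<close> comes from replacing \<open>1 + norm x\<close>
    by twice a maximum, whose \<open>k\<close>-th power is either \<open>1\<close> or
    \<open>norm x ^ k\<close>.\<close>
  have "\<bar>u x\<bar> \<le> (C * 2 ^ k) * (1 + norm x ^ k)" for x
  proof -
    have "(1 + norm x) ^ k \<le> (2 * max 1 (norm x)) ^ k"
      by (intro power_mono) auto
    also have "\<dots> = 2 ^ k * max 1 (norm x) ^ k"
      by (simp add: power_mult_distrib)
    also have "\<dots> \<le> 2 ^ k * (1 + norm x ^ k)"
      by (intro mult_left_mono) (auto simp: max_def)
    finally have "C * (1 + norm x) ^ k \<le> C * (2 ^ k * (1 + norm x ^ k))"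
      using \<open>C \<ge> 0\<close> by (rule mult_left_mono)
    then show ?thesis using C[of x] by (simp add: mult.assoc)
  qed
  then show "poly_bounded u" unfolding poly_bounded_def by blast
qed

lemma poly_bounded_add:
  assumes "poly_bounded u" and "poly_bounded v"
  shows "poly_bounded (\<lambda>x. u x + v x)"
proof -
  from assms obtain C k D l where C: "C \<ge> 0" "\<And>x. \<bar>u x\<bar> \<le> C * (1 + norm x) ^ k"
    and D: "D \<ge> 0" "\<And>x. \<bar>v x\<bar> \<le> D * (1 + norm x) ^ l"
    unfolding poly_bounded_iff by blast
  have "\<bar>u x + v x\<bar> \<le> (C + D) * (1 + norm x) ^ (k + l)" for x
  proof -
    have "C * (1 + norm x) ^ k \<le> C * (1 + norm x) ^ (k + l)"
      "D * (1 + norm x) ^ l \<le> D * (1 + norm x) ^ (k + l)"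
      using C(1) D(1) by (auto intro!: mult_left_mono power_increasing)
    then show ?thesis using C(2)[of x] D(2)[of x] by (simp add: distrib_right)
  qed
  then show ?thesis unfolding poly_bounded_iff using C(1) D(1) by (intro exI[of _ "C + D"]) auto
qed

lemma poly_bounded_uminus: "poly_bounded u \<Longrightarrow> poly_bounded (\<lambda>x. - u x)"
  unfolding poly_bounded_def by simp

lemma poly_bounded_diff:
  "poly_bounded u \<Longrightarrow> poly_bounded v \<Longrightarrow> poly_bounded (\<lambda>x. u x - v x)"
  using poly_bounded_add[of u "\<lambda>x. - v x"] poly_bounded_uminus[of v] by simp

lemma poly_bounded_mult:
  assumes "poly_bounded u" and "poly_bounded v"
  shows "poly_bounded (\<lambda>x. u x * v x)"
proof -
  from assms obtain C k D l where C: "C \<ge> 0" "\<And>x. \<bar>u x\<bar> \<le> C * (1 + norm x) ^ k"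
    and D: "D \<ge> 0" "\<And>x. \<bar>v x\<bar> \<le> D * (1 + norm x) ^ l"
    unfolding poly_bounded_iff by blast
  have "\<bar>u x * v x\<bar> \<le> (C * D) * (1 + norm x) ^ (k + l)" for x
    using mult_mono[OF C(2)[of x] D(2)[of x]] C(1)
    by (simp add: abs_mult power_add mult_ac)
  then show ?thesis unfolding poly_bounded_iff using C(1) D(1) by (intro exI[of _ "C * D"]) auto
qed

lemma poly_bounded_compose:
  assumes "poly_bounded u" and "\<And>z. norm (p z) \<le> norm z"
  shows "poly_bounded (\<lambda>z. u (p z))"
proof -
  from assms(1) obtain C k where C: "C \<ge> 0" "\<And>x. \<bar>u x\<bar> \<le> C * (1 + norm x) ^ k"
    unfolding poly_bounded_iff by blast
  have "\<bar>u (p z)\<bar> \<le> C * (1 + norm z) ^ k" for z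
  proof -
    have "C * (1 + norm (p z)) ^ k \<le> C * (1 + norm z) ^ k"
      using C(1) assms(2) by (intro mult_left_mono power_mono) auto
    then show ?thesis using C(2)[of "p z"] by simp
  qed
  then show ?thesis unfolding poly_bounded_iff using C(1) by blast
qed

section \<open>Partial derivatives of test functions and a coinduction rule\<close>

lemma C_inf_poly_differentiable: "g \<in> C_inf_poly \<Longrightarrow> g differentiable (at x)"
  unfolding C_inf_poly_def by (auto dest: bspec[of _ _ "[]"])

lemma C_inf_poly_poly_bounded: "g \<in> C_inf_poly \<Longrightarrow> poly_bounded g"
  unfolding C_inf_poly_def poly_bounded_def by (drule CollectD, drule bspec[of _ _ "[]"]) simp_all

lemma iter_partial_append: "iter_partial bs (iter_partial cs g) = iter_partial (bs @ cs) g"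
  by (induction bs) simp_all

text \<open>The head of the list is the derivative taken last, so differentiating first along
  \<open>b\<close> and then along \<open>bs\<close> corresponds to the list \<open>bs @ [b]\<close>,
  which is covered by the hypothesis on \<open>g\<close>.\<close>

lemma C_inf_poly_partial:
  assumes "g \<in> C_inf_poly" and "b \<in> Basis"
  shows "(\<lambda>x. frechet_derivative g (at x) b) \<in> C_inf_poly"
proof -
  have *: "iter_partial bs (\<lambda>x. frechet_derivative g (at x) b) = iter_partial (bs @ [b]) g" for bs
    using iter_partial_append[of bs "[b]" g] by simp
  show ?thesis
    unfolding C_inf_poly_def
  proof (intro CollectI ballI)
    fix bs :: "'a list" assume "bs \<in> lists Basis"
    then have "bs @ [b] \<in> lists Basis" using assms(2) by simp
    then show "(\<forall>x. iter_partial bs (\<lambda>x. frechet_derivative g (at x) b) differentiable (at x)) \<and>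
      (\<exists>C. \<exists>k::nat. \<forall>x. \<bar>iter_partial bs (\<lambda>x. frechet_derivative g (at x) b) x\<bar> \<le> C * (1 + norm x ^ k))"
      using assms(1) unfolding C_inf_poly_def * by blast
  qed
qed

text \<open>\<open>C_inf_poly\<close> is the largest set of differentiable, polynomially bounded
  functions that is closed under partial derivatives. Exhibiting any such set around
  \<open>g\<close> replaces explicit formulas for higher derivatives by a check of first
  derivatives.\<close>

lemma C_inf_poly_coinduct:
  assumes "g \<in> S"
    and diff: "\<And>u x. u \<in> S \<Longrightarrow> u differentiable (at x)"
    and bdd: "\<And>u. u \<in> S \<Longrightarrow> poly_bounded u"
    and partial: "\<And>u b. u \<in> S \<Longrightarrow> b \<in> Basis \<Longrightarrow> (\<lambda>x. frechet_derivative u (at x) b) \<in> S"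
  shows "g \<in> C_inf_poly"
proof -
  have "iter_partial bs g \<in> S" if "bs \<in> lists Basis" for bs
    using that by (induction bs) (simp_all add: assms(1) partial)
  then show ?thesis
    unfolding C_inf_poly_def using diff bdd unfolding poly_bounded_def by blast
qed

section \<open>Closure under differences, squares and coordinate projections\<close>

lemma C_inf_poly_zero: "(\<lambda>x::'a::euclidean_space. 0) \<in> C_inf_poly"
proof (rule C_inf_poly_coinduct[where S = "{\<lambda>x. 0}"])
  fix u :: "'a \<Rightarrow> real" assume "u \<in> {\<lambda>x. 0}"
  then show "poly_bounded u" unfolding poly_bounded_def by (auto intro: exI[of _ 0])
qed (auto simp: frechet_derivative_const)

text \<open>The algebra generated by the test functions; Leibniz' rule keeps it closed under partial
  derivatives, whereas the products of test functions alone are not.\<close>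

inductive_set C_inf_poly_alg :: "('a::euclidean_space \<Rightarrow> real) set" where
  base: "g \<in> C_inf_poly \<Longrightarrow> g \<in> C_inf_poly_alg"
| add: "u \<in> C_inf_poly_alg \<Longrightarrow> v \<in> C_inf_poly_alg \<Longrightarrow> (\<lambda>x. u x + v x) \<in> C_inf_poly_alg"
| diff: "u \<in> C_inf_poly_alg \<Longrightarrow> v \<in> C_inf_poly_alg \<Longrightarrow> (\<lambda>x. u x - v x) \<in> C_inf_poly_alg"
| mult: "u \<in> C_inf_poly_alg \<Longrightarrow> v \<in> C_inf_poly_alg \<Longrightarrow> (\<lambda>x. u x * v x) \<in> C_inf_poly_alg"

lemma C_inf_poly_alg_differentiable: "u \<in> C_inf_poly_alg \<Longrightarrow> u differentiable (at x)"
  by (induction rule: C_inf_poly_alg.induct) (auto intro: C_inf_poly_differentiable)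

lemma C_inf_poly_alg_has_derivative:
  "u \<in> C_inf_poly_alg \<Longrightarrow> (u has_derivative frechet_derivative u (at x)) (at x)"
  using C_inf_poly_alg_differentiable frechet_derivative_works by blast

lemma C_inf_poly_alg_partial:
  assumes "u \<in> C_inf_poly_alg" and b: "b \<in> Basis"
  shows "(\<lambda>x. frechet_derivative u (at x) b) \<in> C_inf_poly_alg"
  using assms(1)
proof (induction rule: C_inf_poly_alg.induct)
  case (base g)
  then show ?case by (intro C_inf_poly_alg.base C_inf_poly_partial b)
next
  case (add u v)
  have "frechet_derivative (\<lambda>x. u x + v x) (at x) b
      = frechet_derivative u (at x) b + frechet_derivative v (at x) b" for x
    using fun_cong[OF frechet_derivative_at[OF has_derivative_add[OF
      add(1,2)[THEN C_inf_poly_alg_has_derivative]]], symmetric] .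
  then show ?case using add by (simp add: C_inf_poly_alg.add)
next
  case (diff u v)
  have "frechet_derivative (\<lambda>x. u x - v x) (at x) b
      = frechet_derivative u (at x) b - frechet_derivative v (at x) b" for x
    using fun_cong[OF frechet_derivative_at[OF has_derivative_diff[OF
      diff(1,2)[THEN C_inf_poly_alg_has_derivative]]], symmetric] .
  then show ?case using diff by (simp add: C_inf_poly_alg.diff)
next
  case (mult u v)
  have "frechet_derivative (\<lambda>x. u x * v x) (at x) b
      = u x * frechet_derivative v (at x) b + frechet_derivative u (at x) b * v x" for x
    using fun_cong[OF frechet_derivative_at[OF has_derivative_mult[OF
      mult(1,2)[THEN C_inf_poly_alg_has_derivative]]], symmetric] .
  then show ?case using mult by (simp add: C_inf_poly_alg.add C_inf_poly_alg.mult)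
qed

text \<open>The generated algebra meets the conditions of the coinduction rule, so it contains
  nothing beyond the test functions. Its closure rules thereby become closure rules of
  \<open>C_inf_poly\<close>.\<close>

lemma C_inf_poly_alg_eq: "C_inf_poly_alg = C_inf_poly"
proof
  have bounded: "poly_bounded u" if "u \<in> C_inf_poly_alg" for u :: "'a \<Rightarrow> real"
    using that by (induction rule: C_inf_poly_alg.induct)
      (auto intro: C_inf_poly_poly_bounded poly_bounded_add poly_bounded_diff poly_bounded_mult)
  then show "(C_inf_poly_alg :: ('a \<Rightarrow> real) set) \<subseteq> C_inf_poly"
    using C_inf_poly_alg_differentiable C_inf_poly_alg_partial
    by (blast intro: C_inf_poly_coinduct[where S = C_inf_poly_alg])
qed (blast intro: C_inf_poly_alg.base)

lemma C_inf_poly_diff: "u \<in> C_inf_poly \<Longrightarrow> v \<in> C_inf_poly \<Longrightarrow> (\<lambda>x. u x - v x) \<in> C_inf_poly"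
  using C_inf_poly_alg.diff[of u v] by (simp add: C_inf_poly_alg_eq)

lemma C_inf_poly_square: "u \<in> C_inf_poly \<Longrightarrow> (\<lambda>x. (u x)\<^sup>2) \<in> C_inf_poly"
  using C_inf_poly_alg.mult[of u u] by (simp add: C_inf_poly_alg_eq power2_eq_square)

text \<open>By the chain rule, the partial derivative of \<open>g\<close> after \<open>p\<close>
  along \<open>b\<close> is the derivative of \<open>g\<close> along \<open>p b\<close>, evaluated
  after \<open>p\<close>. Since \<open>p b\<close> is zero or a basis vector, this is again zero or
  a test function composed with \<open>p\<close>, so these compositions form a coinductive
  set.\<close>

lemma C_inf_poly_compose_projection:
  fixes p :: "'b::euclidean_space \<Rightarrow> 'a::euclidean_space"
  assumes "g \<in> C_inf_poly" and p: "bounded_linear p" "\<And>z. norm (p z) \<le> norm z"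
    and basis: "\<And>b. b \<in> Basis \<Longrightarrow> p b \<in> insert 0 Basis"
  shows "(\<lambda>z. g (p z)) \<in> C_inf_poly"
proof (rule C_inf_poly_coinduct[where S = "(\<lambda>u z. u (p z)) ` C_inf_poly"])
  have deriv: "((\<lambda>z. u (p z)) has_derivative (\<lambda>b. frechet_derivative u (at (p z)) (p b))) (at z)"
    if "u \<in> C_inf_poly" for u z
    using has_derivative_compose[OF bounded_linear_imp_has_derivative[OF p(1)]]
      C_inf_poly_differentiable[OF that] frechet_derivative_works by blast
  fix w :: "'b \<Rightarrow> real"
  assume "w \<in> (\<lambda>u z. u (p z)) ` C_inf_poly"
  then obtain u where u: "u \<in> C_inf_poly" "w = (\<lambda>z. u (p z))" by blast
  show "w differentiable (at x)" for x
    using deriv[OF u(1)] u(2) unfolding differentiable_def by blast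
  show "poly_bounded w"
    unfolding u(2) by (rule poly_bounded_compose[OF C_inf_poly_poly_bounded[OF u(1)] p(2)])
  fix b :: 'b assume "b \<in> Basis"
  have *: "frechet_derivative w (at z) b = frechet_derivative u (at (p z)) (p b)" for z
    using frechet_derivative_at[OF deriv[OF u(1)], of z] u(2) by metis
  show "(\<lambda>z. frechet_derivative w (at z) b) \<in> (\<lambda>u z. u (p z)) ` C_inf_poly"
  \<comment> \<open>In a direction annihilated by \<open>p\<close> the derivative vanishes
    identically; it is the composition of the zero test function with \<open>p\<close>.\<close>
  proof (cases "p b = 0")
    case True
    have "frechet_derivative u (at (p z)) 0 = 0" for z
      using C_inf_poly_differentiable[OF u(1)] linear_0 linear_frechet_derivative by blast
    then show ?thesis unfolding * True using C_inf_poly_zero by force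
  next
    case False
    then have "p b \<in> Basis" using basis[OF \<open>b \<in> Basis\<close>] by blast
    from imageI[OF C_inf_poly_partial[OF u(1) this], of "\<lambda>u z. u (p z)"]
    show ?thesis unfolding * .
  qed
qed (use assms(1) in blast)

lemma C_inf_poly_fst:
  fixes g :: "'a::euclidean_space \<Rightarrow> real"
  assumes "g \<in> C_inf_poly"
  shows "(\<lambda>z::'a \<times> 'b::euclidean_space. g (fst z)) \<in> C_inf_poly"
  by (rule C_inf_poly_compose_projection[OF assms])
    (auto simp: bounded_linear_fst norm_fst_le Basis_prod_def)

lemma C_inf_poly_snd:
  fixes g :: "'b::euclidean_space \<Rightarrow> real"
  assumes "g \<in> C_inf_poly"
  shows "(\<lambda>z::'a::euclidean_space \<times> 'b. g (snd z)) \<in> C_inf_poly"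
  by (rule C_inf_poly_compose_projection[OF assms])
    (auto simp: bounded_linear_snd norm_snd_le Basis_prod_def)

section \<open>Sample means\<close>

text \<open>Induction on the index set: the new summand is independent of the sum of the others, so
  the expectation of their product factors. Square integrability of the sum is carried along because
  the induction step expands the variance through second moments.\<close>

lemma (in prob_space) indep_vars_sum_square:
  fixes A :: "'i \<Rightarrow> 'a \<Rightarrow> real"
  assumes "finite I" and "indep_vars (\<lambda>_. borel) A I"
    and "\<And>i. i \<in> I \<Longrightarrow> integrable M (A i)" and "\<And>i. i \<in> I \<Longrightarrow> integrable M (\<lambda>\<omega>. (A i \<omega>)\<^sup>2)"
  shows "integrable M (\<lambda>\<omega>. (\<Sum>i\<in>I. A i \<omega>)\<^sup>2) \<and>
    variance (\<lambda>\<omega>. \<Sum>i\<in>I. A i \<omega>) = (\<Sum>i\<in>I. variance (A i))"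
  using assms
proof (induction I rule: finite_induct)
  case empty
  then show ?case by simp
next
  case (insert j J)
  define S where "S = (\<lambda>\<omega>. \<Sum>i\<in>J. A i \<omega>)"
  have IH: "integrable M (\<lambda>\<omega>. (S \<omega>)\<^sup>2)" "variance S = (\<Sum>i\<in>J. variance (A i))"
    using insert indep_vars_subset[OF insert.prems(1), of J] by (auto simp: S_def)
  have S: "integrable M S" unfolding S_def using insert.prems by simp
  have j: "integrable M (A j)" "integrable M (\<lambda>\<omega>. (A j \<omega>)\<^sup>2)" using insert.prems by auto
  have ind: "indep_var borel (A j) borel S"
    unfolding S_def by (rule indep_vars_sum[OF insert.hyps insert.prems(1)])
  note prod = indep_var_integrable[OF ind j(1) S] indep_var_lebesgue_integral[OF ind j(1) S]
  have eq: "(A j \<omega> + S \<omega>)\<^sup>2 = (A j \<omega>)\<^sup>2 + (S \<omega>)\<^sup>2 + 2 * (A j \<omega> * S \<omega>)" for \<omega>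
    by (simp add: power2_sum)
  have int2: "integrable M (\<lambda>\<omega>. (A j \<omega> + S \<omega>)\<^sup>2)"
    unfolding eq using j IH(1) prod(1) by simp
  have "expectation (\<lambda>\<omega>. (A j \<omega> + S \<omega>)\<^sup>2)
      = expectation (\<lambda>\<omega>. (A j \<omega>)\<^sup>2) + expectation (\<lambda>\<omega>. (S \<omega>)\<^sup>2)
        + 2 * (expectation (A j) * expectation S)"
    unfolding eq using j IH(1) prod by simp
  moreover have "variance (\<lambda>\<omega>. A j \<omega> + S \<omega>)
      = expectation (\<lambda>\<omega>. (A j \<omega> + S \<omega>)\<^sup>2) - (expectation (A j) + expectation S)\<^sup>2"
    using variance_eq[OF Bochner_Integration.integrable_add[OF j(1) S] int2] j(1) S by simp
  \<comment> \<open>The cross term \<open>2 * (expectation (A j) * expectation S)\<close> occurs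
    both in the second moment and in the squared mean, and cancels.\<close>
  ultimately have "variance (\<lambda>\<omega>. A j \<omega> + S \<omega>) = variance (A j) + variance S"
    using variance_eq[OF j] variance_eq[OF S IH(1)] by (simp add: power2_sum)
  then show ?case
    using int2 insert.hyps IH(2) unfolding S_def by simp
qed

text \<open>Carries moments of the samples on \<open>M\<close> over to the integrators on
  \<open>Q\<close>; it is applied with \<open>g\<close> the identity and the square.\<close>

lemma
  fixes B :: "'q \<Rightarrow> 'a::topological_space" and g :: "'a \<Rightarrow> real"
  assumes "distr M borel A = distr Q borel B" and "A \<in> borel_measurable M"
    and "B \<in> borel_measurable Q" and "g \<in> borel_measurable borel"
  shows integrable_distr_cong: "integrable M (\<lambda>\<omega>. g (A \<omega>)) = integrable Q (\<lambda>\<omega>. g (B \<omega>))"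
    and integral_distr_cong: "(LINT \<omega>|M. g (A \<omega>)) = (LINT \<omega>|Q. g (B \<omega>))"
  using integrable_distr_eq[of A M borel g] integrable_distr_eq[of B Q borel g]
    integral_distr[of A M borel g] integral_distr[of B Q borel g] assms by simp_all

text \<open>The variance is bounded by the second moment of \<open>B\<close> rather than by its
  variance, because second moments are what weak approximation controls when applied to a squared
  test function.\<close>

lemma (in prob_space)
  assumes n: "n > 0" and indep: "indep_vars (\<lambda>_. borel) A {1..n}"
    and distr: "\<And>i. i \<in> {1..n} \<Longrightarrow> distr M borel (A i) = distr Q borel B"
    and B: "integrable Q B" "integrable Q (\<lambda>\<omega>. (B \<omega>)\<^sup>2)"
  shows integrable_sample_mean: "integrable M (sample_mean n A)"
    and integrable_sample_mean_square: "integrable M (\<lambda>\<omega>. (sample_mean n A \<omega>)\<^sup>2)"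
    and expectation_sample_mean: "expectation (sample_mean n A) = (LINT \<omega>|Q. B \<omega>)"
    and variance_sample_mean_le:
      "variance (sample_mean n A) \<le> (LINT \<omega>|Q. (B \<omega>)\<^sup>2) * inverse (real n)"
proof -
  have Bm: "B \<in> borel_measurable Q" using B(1) by simp
  have Am: "A i \<in> borel_measurable M" if "i \<in> {1..n}" for i
    using indep that unfolding indep_vars_def by blast
  have A1: "integrable M (A i)" "expectation (A i) = (LINT \<omega>|Q. B \<omega>)" if "i \<in> {1..n}" for i
    using integrable_distr_cong[OF distr Am Bm, of _ "\<lambda>x. x"]
      integral_distr_cong[OF distr Am Bm, of _ "\<lambda>x. x"] B(1) that by auto
  have A2: "integrable M (\<lambda>\<omega>. (A i \<omega>)\<^sup>2)" "expectation (\<lambda>\<omega>. (A i \<omega>)\<^sup>2) = (LINT \<omega>|Q. (B \<omega>)\<^sup>2)"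
    if "i \<in> {1..n}" for i
    using integrable_distr_cong[OF distr Am Bm, of _ "\<lambda>x. x\<^sup>2"]
      integral_distr_cong[OF distr Am Bm, of _ "\<lambda>x. x\<^sup>2"] B(2) that by auto
  define S where "S = (\<lambda>\<omega>. \<Sum>i=1..n. A i \<omega>)"
  have mean: "sample_mean n A = (\<lambda>\<omega>. S \<omega> / real n)"
    by (simp add: sample_mean_def S_def fun_eq_iff)
  have S: "integrable M (\<lambda>\<omega>. (S \<omega>)\<^sup>2)" "variance S = (\<Sum>i=1..n. variance (A i))"
    using indep_vars_sum_square[OF _ indep A1(1) A2(1)] unfolding S_def by auto
  have S1: "integrable M S" unfolding S_def by (intro Bochner_Integration.integrable_sum A1(1))
  show "integrable M (sample_mean n A)" unfolding mean using S1 by simp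
  show "integrable M (\<lambda>\<omega>. (sample_mean n A \<omega>)\<^sup>2)" unfolding mean using S by (simp add: power_divide)
  show "expectation (sample_mean n A) = (LINT \<omega>|Q. B \<omega>)"
    unfolding mean using n A1 by (simp add: S_def)
  have "variance (sample_mean n A) = variance S / (real n)\<^sup>2"
  proof -
    have "(S \<omega> / real n - expectation S / real n)\<^sup>2 = (S \<omega> - expectation S)\<^sup>2 / (real n)\<^sup>2" for \<omega>
      by (simp add: diff_divide_distrib[symmetric] power_divide)
    then show ?thesis unfolding mean by simp
  qed
  \<comment> \<open>Each of the \<open>n\<close> variances is at most the common second moment;
    dividing by the square of \<open>n\<close> leaves one factor
    \<open>inverse (real n)\<close>.\<close>
  also have "\<dots> \<le> (real n * (LINT \<omega>|Q. (B \<omega>)\<^sup>2)) / (real n)\<^sup>2"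
  proof (rule divide_right_mono)
    have "variance (A i) \<le> (LINT \<omega>|Q. (B \<omega>)\<^sup>2)" if "i \<in> {1..n}" for i
      using variance_eq[OF A1(1) A2(1), OF that that] A2(2)[OF that] by simp
    from sum_mono[of "{1..n}" "\<lambda>i. variance (A i)", OF this]
    show "variance S \<le> real n * (LINT \<omega>|Q. (B \<omega>)\<^sup>2)" unfolding S(2) by simp
  qed simp
  also have "\<dots> = (LINT \<omega>|Q. (B \<omega>)\<^sup>2) * inverse (real n)"
    using n by (simp add: power2_eq_square field_simps)
  finally show "variance (sample_mean n A) \<le> (LINT \<omega>|Q. (B \<omega>)\<^sup>2) * inverse (real n)" .
qed

section \<open>Moment bounds from weak approximation\<close>

text \<open>The constants \<open>K\<close> and \<open>h0\<close> depend on the test function, so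
  this rule is used once for each test function that the proof needs.\<close>

lemma weak_approximationE:
  assumes "weak_approximation \<alpha> Q U_num M U" and "\<psi> \<in> C_inf_poly" and "T > 0"
  obtains K h0 where "K > 0" "h0 > 0" "integrable M (\<lambda>\<omega>. \<psi> (U T \<omega>))"
    "\<And>h n. 0 < h \<Longrightarrow> h \<le> h0 \<Longrightarrow> real n * h = T \<Longrightarrow> integrable Q (\<lambda>\<omega>. \<psi> (U_num h n \<omega>))"
    "\<And>h n. 0 < h \<Longrightarrow> h \<le> h0 \<Longrightarrow> real n * h = T \<Longrightarrow>
      \<bar>(LINT \<omega>|M. \<psi> (U T \<omega>)) - (LINT \<omega>|Q. \<psi> (U_num h n \<omega>))\<bar> \<le> K * h powr \<alpha>"
proof -
  have int: "integrable M (\<lambda>\<omega>. \<psi> (U T \<omega>))"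
    and "\<exists>K>0. \<exists>h0>0. \<forall>h n. 0 < h \<and> h \<le> h0 \<and> real n * h = T \<longrightarrow>
           integrable Q (\<lambda>\<omega>. \<psi> (U_num h n \<omega>)) \<and>
           \<bar>(LINT \<omega>|M. \<psi> (U T \<omega>)) - (LINT \<omega>|Q. \<psi> (U_num h n \<omega>))\<bar> \<le> K * h powr \<alpha>"
    using assms unfolding weak_approximation_def by blast+
  then obtain K h0 where "K > 0" "h0 > 0" "\<forall>h n. 0 < h \<and> h \<le> h0 \<and> real n * h = T \<longrightarrow>
           integrable Q (\<lambda>\<omega>. \<psi> (U_num h n \<omega>)) \<and>
           \<bar>(LINT \<omega>|M. \<psi> (U T \<omega>)) - (LINT \<omega>|Q. \<psi> (U_num h n \<omega>))\<bar> \<le> K * h powr \<alpha>" by blast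
  with int show ?thesis by (intro that[of K h0]) auto
qed

section \<open>The multilevel estimates\<close>

theorem theorem3p2:
  fixes M :: "'w measure" and F :: "real \<Rightarrow> 'w measure" and Q :: "'q measure"
    and W :: "real \<Rightarrow> 'w \<Rightarrow> real^'m"
    and f :: "real^'d \<Rightarrow> real^'d" and G :: "real^'d \<Rightarrow> real^'m^'d" and X0 :: "real^'d"
    and X Y :: "real \<Rightarrow> 'w \<Rightarrow> real^'d"
    and Xn Yn :: "real \<Rightarrow> nat \<Rightarrow> 'q \<Rightarrow> real^'d"
    and T :: real and \<phi> :: "real^'d \<Rightarrow> real"
  assumes "prob_space M" and "prob_space Q"
    and "filtration (space M) F" and "\<And>t. sets (F t) \<subseteq> sets M"
    and "brownian_motion M F W"
    and "sde_well_posed M F W f G X0"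
    and "doubled_up_solution M F W f G X0 (\<lambda>t \<omega>. (X t \<omega>, Y t \<omega>))"
    and "weak_approximation 2 Q (\<lambda>h n \<omega>. (Xn h n \<omega>, Yn h n \<omega>)) M (\<lambda>t \<omega>. (X t \<omega>, Y t \<omega>))"
    and "T > 0" and "\<phi> \<in> C_inf_poly"
  shows "\<exists>hbar>0. \<forall>M0::nat. M0 > 0 \<and> (\<forall>l. level_h T M0 l \<le> hbar) \<and>
      level_consistent T M0 \<phi> Q Xn Yn \<longrightarrow>
    (\<exists>\<alpha>\<ge>1/2. \<exists>c1>0. \<exists>c2>0. \<forall>N Pf Pc.
      (\<forall>l. N l > 0) \<and> mlmc_samples T M0 \<phi> Q Xn Yn M N Pf Pc \<longrightarrow>
      (\<forall>l.
        integrable M (\<lambda>\<omega>. \<phi> (X T \<omega>)) \<and> integrable M (P_hat N Pf l) \<and>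
        integrable M (Y_hat N Pf Pc l) \<and> integrable M (\<lambda>\<omega>. (Y_hat N Pf Pc l \<omega>)\<^sup>2) \<and>
        \<bar>prob_space.expectation M (\<lambda>\<omega>. P_hat N Pf l \<omega> - \<phi> (X T \<omega>))\<bar> \<le> c1 * level_h T M0 l powr \<alpha> \<and>
        prob_space.expectation M (Y_hat N Pf Pc l) =
          (if l = 0 then prob_space.expectation M (P_hat N Pf 0)
           else prob_space.expectation M (\<lambda>\<omega>. P_hat N Pf l \<omega> - P_hat N Pf (l - 1) \<omega>)) \<and>
        prob_space.variance M (Y_hat N Pf Pc l) \<le> c2 * inverse (real (N l)) * (level_h T M0 l)\<^sup>2))"
proof -
  interpret M: prob_space M by fact
  define Z where "Z = (\<lambda>h n \<omega>. (Xn h n \<omega>, Yn h n \<omega>))"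
  define U where "U = (\<lambda>t \<omega>. (X t \<omega>, Y t \<omega>))"
  have wk: "weak_approximation 2 Q Z M U" using assms(8) unfolding Z_def U_def .
  have \<phi>X: "(\<lambda>z::(real^'d) \<times> (real^'d). \<phi> (fst z)) \<in> C_inf_poly"
    using \<open>\<phi> \<in> C_inf_poly\<close> by (rule C_inf_poly_fst)
  have \<phi>Y: "(\<lambda>z::(real^'d) \<times> (real^'d). \<phi> (snd z)) \<in> C_inf_poly"
    using \<open>\<phi> \<in> C_inf_poly\<close> by (rule C_inf_poly_snd)
  \<comment> \<open>Testing with \<phi> of the first component yields the bias bound.\<close>
  obtain K1 h1 where K1: "K1 > 0" "h1 > 0" "integrable M (\<lambda>\<omega>. \<phi> (X T \<omega>))"
    "\<And>h n. 0 < h \<Longrightarrow> h \<le> h1 \<Longrightarrow> real n * h = T \<Longrightarrow> integrable Q (\<lambda>\<omega>. \<phi> (Xn h n \<omega>))"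
    "\<And>h n. 0 < h \<Longrightarrow> h \<le> h1 \<Longrightarrow> real n * h = T \<Longrightarrow>
      \<bar>(LINT \<omega>|M. \<phi> (X T \<omega>)) - (LINT \<omega>|Q. \<phi> (Xn h n \<omega>))\<bar> \<le> K1 * h powr 2"
    by (rule weak_approximationE[OF wk \<phi>X \<open>T > 0\<close>]) (simp add: Z_def U_def)
  \<comment> \<open>From the squared test function only integrability is kept: the fine samples need
    finite second moments.\<close>
  obtain h2 where h2: "h2 > 0"
    "\<And>h n. 0 < h \<Longrightarrow> h \<le> h2 \<Longrightarrow> real n * h = T \<Longrightarrow> integrable Q (\<lambda>\<omega>. (\<phi> (Xn h n \<omega>))\<^sup>2)"
    by (rule weak_approximationE[OF wk C_inf_poly_square[OF \<phi>X] \<open>T > 0\<close>]) (simp add: Z_def U_def)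
  \<comment> \<open>Integrability of the coarse quantity, so that the expectation of a level
    difference splits.\<close>
  obtain h3 where h3: "h3 > 0"
    "\<And>h n. 0 < h \<Longrightarrow> h \<le> h3 \<Longrightarrow> real n * h = T \<Longrightarrow> integrable Q (\<lambda>\<omega>. \<phi> (Yn h n \<omega>))"
    by (rule weak_approximationE[OF wk \<phi>Y \<open>T > 0\<close>]) (simp add: Z_def U_def)
  \<comment> \<open>The squared difference of \<phi> at the two components is the test function that
    controls the variance of the level differences.\<close>
  obtain K4 h4 where K4: "K4 > 0" "h4 > 0"
    "\<And>h n. 0 < h \<Longrightarrow> h \<le> h4 \<Longrightarrow> real n * h = T \<Longrightarrow>
      integrable Q (\<lambda>\<omega>. (\<phi> (Xn h n \<omega>) - \<phi> (Yn h n \<omega>))\<^sup>2)"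
    "\<And>h n. 0 < h \<Longrightarrow> h \<le> h4 \<Longrightarrow> real n * h = T \<Longrightarrow>
      \<bar>(LINT \<omega>|M. (\<phi> (X T \<omega>) - \<phi> (Y T \<omega>))\<^sup>2) - (LINT \<omega>|Q. (\<phi> (Xn h n \<omega>) - \<phi> (Yn h n \<omega>))\<^sup>2)\<bar>
        \<le> K4 * h powr 2"
    by (rule weak_approximationE[OF wk C_inf_poly_square[OF C_inf_poly_diff[OF \<phi>X \<phi>Y]] \<open>T > 0\<close>])
      (simp add: Z_def U_def)
  \<comment> \<open>Both components solve the same equation, so pathwise uniqueness identifies them
    and the exact value of the squared difference vanishes.\<close>
  have "AE \<omega> in M. \<forall>t\<ge>0. X t \<omega> = Y t \<omega>"
    using assms(6,7) unfolding sde_well_posed_def doubled_up_solution_def by simp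
  then have "AE \<omega> in M. (\<phi> (X T \<omega>) - \<phi> (Y T \<omega>))\<^sup>2 = 0"
    using \<open>T > 0\<close> by (auto elim!: eventually_mono)
  then have "(LINT \<omega>|M. (\<phi> (X T \<omega>) - \<phi> (Y T \<omega>))\<^sup>2) = 0"
    by (rule integral_eq_zero_AE)
  \<comment> \<open>With exact expectation 0, the weak error bound is itself a bound on the second
    moment.\<close>
  with K4(4) have K4': "(LINT \<omega>|Q. (\<phi> (Xn h n \<omega>) - \<phi> (Yn h n \<omega>))\<^sup>2) \<le> K4 * h\<^sup>2"
    if "0 < h" "h \<le> h4" "real n * h = T" for h n
    using that by fastforce
  \<comment> \<open>One threshold serves all four test functions; it is fixed before
    \<open>M0\<close>.\<close>
  define hbar where "hbar = min (min h1 h2) (min h3 h4)"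
  have "hbar > 0" using K1(2) h2(1) h3(1) K4(2) unfolding hbar_def by simp
  show ?thesis
  proof (rule exI[of _ hbar], rule conjI, fact, intro allI impI)
    fix M0 :: nat
    assume H: "M0 > 0 \<and> (\<forall>l. level_h T M0 l \<le> hbar) \<and> level_consistent T M0 \<phi> Q Xn Yn"
    define h where "h = level_h T M0"
    define n where "n = level_steps M0"
    define PX where "PX = (\<lambda>l \<omega>. \<phi> (Xn (h l) (n l) \<omega>))"
    define PY where "PY = (\<lambda>l \<omega>. \<phi> (Yn (h l) (n l) \<omega>))"
    have "n l > 0" for l using H by (simp add: n_def level_steps_def)
    then have h: "0 < h l" "real (n l) * h l = T" for l
      using \<open>T > 0\<close> by (simp_all add: h_def n_def level_h_def)
    have h_le: "h l \<le> h1" "h l \<le> h2" "h l \<le> h3" "h l \<le> h4" for l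
      using H unfolding h_def hbar_def by simp_all
    have PX: "integrable Q (PX l)" "integrable Q (\<lambda>\<omega>. (PX l \<omega>)\<^sup>2)" for l
      unfolding PX_def using K1(4) h2(2) h h_le by blast+
    have PY: "integrable Q (PY l)" for l
      unfolding PY_def using h3(2) h h_le by blast
    have PD: "integrable Q (\<lambda>\<omega>. (PX l \<omega> - PY l \<omega>)\<^sup>2)"
      "(LINT \<omega>|Q. (PX l \<omega> - PY l \<omega>)\<^sup>2) \<le> K4 * (h l)\<^sup>2" for l
      unfolding PX_def PY_def using K4(3) K4' h h_le by blast+
    have bias: "\<bar>(LINT \<omega>|M. \<phi> (X T \<omega>)) - (LINT \<omega>|Q. PX l \<omega>)\<bar> \<le> K1 * h l powr 2" for l
      unfolding PX_def using K1(5) h h_le by blast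
    \<comment> \<open>Consistency of the levels enters only through expectations: the coarse mean on
      level \<open>l\<close> is the fine mean on level \<open>l - 1\<close>.\<close>
    have cons: "(LINT \<omega>|Q. PY l \<omega>) = (LINT \<omega>|Q. PX (l - 1) \<omega>)" if "l \<ge> 1" for l
    proof -
      have "distr Q borel (PY l) = distr Q borel (PX (l - 1))"
        using H that unfolding level_consistent_def PX_def PY_def h_def n_def by blast
      from integral_distr_cong[OF this PY[THEN borel_measurable_integrable]
        PX(1)[THEN borel_measurable_integrable], of "\<lambda>x. x"]
      show ?thesis by simp
    qed
    define V0 where "V0 = (LINT \<omega>|Q. (PX 0 \<omega>)\<^sup>2)"
    \<comment> \<open>\<open>K4\<close> serves the levels \<open>l \<ge> 1\<close>. Level 0 has no
      coarse partner and no small second moment, so \<open>V0\<close> is divided by the fixed number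
      \<open>(h 0)\<^sup>2\<close> to fit the same form. The result depends neither on the level nor
      on the sample numbers.\<close>
    define c2 where "c2 = K4 + V0 / (h 0)\<^sup>2"
    have "V0 \<ge> 0" unfolding V0_def by simp
    then have c2: "c2 > 0" "K4 \<le> c2" "V0 \<le> c2 * (h 0)\<^sup>2"
      using K4(1) h(1)[of 0] by (simp_all add: c2_def add_pos_nonneg distrib_right)
    show "\<exists>\<alpha>\<ge>1/2. \<exists>c1>0. \<exists>c2>0. \<forall>N Pf Pc.
      (\<forall>l. N l > 0) \<and> mlmc_samples T M0 \<phi> Q Xn Yn M N Pf Pc \<longrightarrow>
      (\<forall>l.
        integrable M (\<lambda>\<omega>. \<phi> (X T \<omega>)) \<and> integrable M (P_hat N Pf l) \<and>
        integrable M (Y_hat N Pf Pc l) \<and> integrable M (\<lambda>\<omega>. (Y_hat N Pf Pc l \<omega>)\<^sup>2) \<and>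
        \<bar>prob_space.expectation M (\<lambda>\<omega>. P_hat N Pf l \<omega> - \<phi> (X T \<omega>))\<bar> \<le> c1 * level_h T M0 l powr \<alpha> \<and>
        prob_space.expectation M (Y_hat N Pf Pc l) =
          (if l = 0 then prob_space.expectation M (P_hat N Pf 0)
           else prob_space.expectation M (\<lambda>\<omega>. P_hat N Pf l \<omega> - P_hat N Pf (l - 1) \<omega>)) \<and>
        prob_space.variance M (Y_hat N Pf Pc l) \<le> c2 * inverse (real (N l)) * (level_h T M0 l)\<^sup>2)"
    \<comment> \<open>The exponent is the weak order 2 and \<open>c1\<close> is the weak error
      constant \<open>K1\<close>; all witnesses are fixed before the sample numbers and the
      samples.\<close>
    proof (rule exI[of _ 2], rule conjI, simp, rule exI[of _ K1], rule conjI, fact,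
        rule exI[of _ c2], rule conjI, fact, intro allI impI)
      fix N :: "nat \<Rightarrow> nat" and Pf Pc :: "nat \<Rightarrow> nat \<Rightarrow> 'w \<Rightarrow> real" and l :: nat
      assume NS: "(\<forall>l. N l > 0) \<and> mlmc_samples T M0 \<phi> Q Xn Yn M N Pf Pc"
      then have N: "N l > 0" for l by blast
      have pair: "M.indep_vars (\<lambda>_. borel) (\<lambda>i \<omega>. (Pf l i \<omega>, Pc l i \<omega>)) {1..N l}"
        "\<And>i. i \<in> {1..N l} \<Longrightarrow>
          distr M borel (\<lambda>\<omega>. (Pf l i \<omega>, Pc l i \<omega>)) = distr Q borel (\<lambda>\<omega>. (PX l \<omega>, PY l \<omega>))"
        if "l \<ge> 1" for l
        using NS that unfolding mlmc_samples_def PX_def PY_def h_def n_def by blast+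
      \<comment> \<open>A Borel image of the i.i.d. pairs is again i.i.d.; \<open>fst\<close> will
        give the fine samples and \<open>fst z - snd z\<close> the level differences.\<close>
      have image: "M.indep_vars (\<lambda>_. borel) (\<lambda>i \<omega>. g (Pf l i \<omega>, Pc l i \<omega>)) {1..N l}"
        "\<And>i. i \<in> {1..N l} \<Longrightarrow>
          distr M borel (\<lambda>\<omega>. g (Pf l i \<omega>, Pc l i \<omega>)) = distr Q borel (\<lambda>\<omega>. g (PX l \<omega>, PY l \<omega>))"
        if "l \<ge> 1" and g: "g \<in> borel_measurable borel" for l and g :: "real \<times> real \<Rightarrow> real"
      proof -
        show "M.indep_vars (\<lambda>_. borel) (\<lambda>i \<omega>. g (Pf l i \<omega>, Pc l i \<omega>)) {1..N l}"
          using M.indep_vars_compose2[OF pair(1)[OF \<open>l \<ge> 1\<close>], of "\<lambda>_. g" "\<lambda>_. borel"] g by simp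
        fix i assume i: "i \<in> {1..N l}"
        have m1: "(\<lambda>\<omega>. (Pf l i \<omega>, Pc l i \<omega>)) \<in> borel_measurable M"
          using pair(1)[OF \<open>l \<ge> 1\<close>] i unfolding M.indep_vars_def by blast
        have m2: "(\<lambda>\<omega>. (PX l \<omega>, PY l \<omega>)) \<in> borel_measurable Q"
          using PX(1)[of l] PY[of l] by (intro borel_measurable_Pair) simp_all
        show "distr M borel (\<lambda>\<omega>. g (Pf l i \<omega>, Pc l i \<omega>)) = distr Q borel (\<lambda>\<omega>. g (PX l \<omega>, PY l \<omega>))"
          using distr_distr[OF g m1] distr_distr[OF g m2] pair(2)[OF \<open>l \<ge> 1\<close> i]
          by (simp add: comp_def)
      qed
      \<comment> \<open>Level 0 provides its fine samples directly, while on higher levels they are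
        the first coordinates of the pairs. All levels are needed, as the mean identity on level
        \<open>l\<close> also involves level \<open>l - 1\<close>.\<close>
      have "M.indep_vars (\<lambda>_. borel) (Pf l) {1..N l} \<and>
        (\<forall>i\<in>{1..N l}. distr M borel (Pf l i) = distr Q borel (PX l))" for l
      proof (cases "l = 0")
        case True
        then show ?thesis using NS unfolding mlmc_samples_def PX_def h_def n_def by blast
      next
        case False
        then have "l \<ge> 1" by simp
        moreover have "(fst :: real \<times> real \<Rightarrow> real) \<in> borel_measurable borel"
          by (intro borel_measurable_continuous_onI continuous_intros)
        ultimately show ?thesis using image[of l fst] unfolding fst_conv by blast
      qed
      then have fine: "M.indep_vars (\<lambda>_. borel) (Pf l) {1..N l}"
        "\<And>i. i \<in> {1..N l} \<Longrightarrow> distr M borel (Pf l i) = distr Q borel (PX l)" for l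
        by blast+
      note fine_mean = M.integrable_sample_mean[OF N fine PX]
        M.integrable_sample_mean_square[OF N fine PX]
        M.expectation_sample_mean[OF N fine PX]
        M.variance_sample_mean_le[OF N fine PX]
      have P_int: "integrable M (P_hat N Pf l)" "M.expectation (P_hat N Pf l) = (LINT \<omega>|Q. PX l \<omega>)"
        for l unfolding P_hat_def using fine_mean by blast+
      have Y: "integrable M (Y_hat N Pf Pc l) \<and> integrable M (\<lambda>\<omega>. (Y_hat N Pf Pc l \<omega>)\<^sup>2) \<and>
        M.expectation (Y_hat N Pf Pc l) =
          (if l = 0 then M.expectation (P_hat N Pf 0)
           else M.expectation (\<lambda>\<omega>. P_hat N Pf l \<omega> - P_hat N Pf (l - 1) \<omega>)) \<and>
        M.variance (Y_hat N Pf Pc l) \<le> c2 * inverse (real (N l)) * (h l)\<^sup>2"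
      proof (cases "l = 0")
        case True
        have "M.variance (P_hat N Pf 0) \<le> V0 * inverse (real (N 0))"
          unfolding P_hat_def V0_def by (rule fine_mean)
        \<comment> \<open>On level 0 the second summand of \<open>c2\<close> absorbs the second
          moment.\<close>
        also have "\<dots> \<le> (c2 * (h 0)\<^sup>2) * inverse (real (N 0))"
          using c2(3) by (intro mult_right_mono) simp_all
        finally have "M.variance (P_hat N Pf 0) \<le> c2 * inverse (real (N 0)) * (h 0)\<^sup>2"
          by (simp add: mult_ac)
        then show ?thesis
          using True P_int(1)[of 0] fine_mean(2)[of 0] unfolding Y_hat_def P_hat_def by simp
      next
        case False
        then have l: "l \<ge> 1" by simp
        have D: "(\<lambda>z::real \<times> real. fst z - snd z) \<in> borel_measurable borel"
          by (intro borel_measurable_continuous_onI continuous_intros)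
        have PD_int: "integrable Q (\<lambda>\<omega>. PX l \<omega> - PY l \<omega>)" using PX(1) PY by simp
        note im = image[OF l D, simplified fst_conv snd_conv]
        note diff_mean = M.integrable_sample_mean[OF N im PD_int PD(1)]
          M.integrable_sample_mean_square[OF N im PD_int PD(1)]
          M.expectation_sample_mean[OF N im PD_int PD(1)]
          M.variance_sample_mean_le[OF N im PD_int PD(1)]
        have Yh: "Y_hat N Pf Pc l = sample_mean (N l) (\<lambda>i \<omega>. Pf l i \<omega> - Pc l i \<omega>)"
          using False by (simp add: Y_hat_def)
        have "M.variance (Y_hat N Pf Pc l) \<le> (LINT \<omega>|Q. (PX l \<omega> - PY l \<omega>)\<^sup>2) * inverse (real (N l))"
          unfolding Yh by (rule diff_mean)
        also have "\<dots> \<le> (c2 * (h l)\<^sup>2) * inverse (real (N l))"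
          using order_trans[OF PD(2)[of l] mult_right_mono[OF c2(2), of "(h l)\<^sup>2"]]
          by (intro mult_right_mono) simp_all
        finally have "M.variance (Y_hat N Pf Pc l) \<le> c2 * inverse (real (N l)) * (h l)\<^sup>2"
          by (simp add: mult_ac)
        \<comment> \<open>The coarse samples on level \<open>l\<close> and the fine samples on level
          \<open>l - 1\<close> may be different random variables with different sample numbers;
          equality of their means suffices by linearity.\<close>
        moreover have "M.expectation (Y_hat N Pf Pc l)
            = M.expectation (\<lambda>\<omega>. P_hat N Pf l \<omega> - P_hat N Pf (l - 1) \<omega>)"
          unfolding Yh using diff_mean(3) PX(1) PY P_int cons[OF l] by simp
        ultimately show ?thesis
          using False diff_mean(1,2) unfolding Yh by simp
      qed
      \<comment> \<open>Averaging leaves the mean unchanged, so the bias of the estimator is the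
        weak error of a single sample.\<close>
      have "\<bar>M.expectation (\<lambda>\<omega>. P_hat N Pf l \<omega> - \<phi> (X T \<omega>))\<bar> \<le> K1 * h l powr 2"
        using bias[of l] P_int[of l] K1(3) by (simp add: abs_minus_commute)
      with Y K1(3) P_int(1)[of l] show "integrable M (\<lambda>\<omega>. \<phi> (X T \<omega>)) \<and> integrable M (P_hat N Pf l) \<and>
        integrable M (Y_hat N Pf Pc l) \<and> integrable M (\<lambda>\<omega>. (Y_hat N Pf Pc l \<omega>)\<^sup>2) \<and>
        \<bar>M.expectation (\<lambda>\<omega>. P_hat N Pf l \<omega> - \<phi> (X T \<omega>))\<bar> \<le> K1 * level_h T M0 l powr 2 \<and>
        M.expectation (Y_hat N Pf Pc l) =
          (if l = 0 then M.expectation (P_hat N Pf 0)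
           else M.expectation (\<lambda>\<omega>. P_hat N Pf l \<omega> - P_hat N Pf (l - 1) \<omega>)) \<and>
        M.variance (Y_hat N Pf Pc l) \<le> c2 * inverse (real (N l)) * (level_h T M0 l)\<^sup>2"
        unfolding h_def by blast
    qed
  qed
qed

end
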